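(* Let $G=(V,A)$ be a finite directed graph with capacities $u_{ij}\in\mathbb{Q}^+$ for $(i,j)\in A$, and let $(s_k,t_k,d_k)$, $k\in K$, be a finite family of commodities with $s_k,t_k\in V$, $s_k\neq t_k$ and demand $d_k\ge 0$. Every optimal solution of the program $$\min\; z(\mathbf f)=\sum_{(i,j)\in A}\int_0^{f_{ij}}h_{ij}(\omega)\,d\omega\quad\text{over all pseudo-flows } \mathbf f=(f^k_{ij})_{k\in K,(i,j)\in A},\qquad f_{ij}=\sum_{k\in K}f^k_{ij},$$ is an equilibrium pseudo-flow.
   Context: For $i\in V$ put $\delta^+(i)=\{j : (i,j)\in A\}$ and $\delta^-(i)=\{j : (j,i)\in A\}$. A pseudo-flow is a family of real numbers $\mathbf f=(f^k_{ij})_{k\in K,(i,j)\in A}$ with $f^k_{ij}\ge 0$ satisfying flow conservation: for all $k\in K$, $i\in V$, $\sum_{j\in\delta^+(i)}f^k_{ij}-\sum_{j\in\delta^-(i)}f^k_{ji}$ equals $d_k$ if $i=s_k$, $-d_k$ if $i=t_k$, and $0$ otherwise. No capacity constraint is imposed. The penalty function of arc $(i,j)$ is $h_{ij}(x)=0$ if $x\le u_{ij}$ and $h_{ij}(x)=x-u_{ij}$ if $x>u_{ij}$. Given a pseudo-flow, the length of a path is the sum of $h_{ij}(f_{ij})$ over its arcs $(i,j)$. For commodity $k$, a directed path $p$ from $s_k$ to $t_k$ is used if there is $s_k$-$t_k$ flow on $p$, i.e. $f^k_{ij}>0$ for every arc $(i,j)$ of $p$; otherwise it is unused. A pseudo-flow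 is an equilibrium pseudo-flow if for every $k\in K$: (i) all used paths from $s_k$ to $t_k$ have equal length, which is the minimum length among all paths from $s_k$ to $t_k$; (ii) all unused paths from $s_k$ to $t_k$ have greater or equal length. *)

theory Defs
  imports "HOL-Analysis.Analysis" "Graph_Theory.Pair_Digraph"
begin

definition out_nbrs :: "'v pair_pre_digraph \<Rightarrow> 'v \<Rightarrow> 'v set" where
  "out_nbrs G i = {j. (i, j) \<in> parcs G}"

definition in_nbrs :: "'v pair_pre_digraph \<Rightarrow> 'v \<Rightarrow> 'v set" where
  "in_nbrs G i = {j. (j, i) \<in> parcs G}"

(* A family (f^k_ij) indexed by K and the arcs is a total function f with f k (i, j) = f^k_ij;
   nothing below depends on its values outside this index set. *)
type_synonym ('k, 'v) flow_family = "'k \<Rightarrow> 'v \<times> 'v \<Rightarrow> real"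

definition pseudo_flow ::
  "'v pair_pre_digraph \<Rightarrow> 'k set \<Rightarrow> ('k \<Rightarrow> 'v) \<Rightarrow> ('k \<Rightarrow> 'v) \<Rightarrow> ('k \<Rightarrow> real)
     \<Rightarrow> ('k, 'v) flow_family \<Rightarrow> bool" where
  "pseudo_flow G K s t d f \<longleftrightarrow>
     (\<forall>k\<in>K. \<forall>e\<in>parcs G. 0 \<le> f k e) \<and>
     (\<forall>k\<in>K. \<forall>i\<in>pverts G.
        (\<Sum>j\<in>out_nbrs G i. f k (i, j)) - (\<Sum>j\<in>in_nbrs G i. f k (j, i)) =
        (if i = s k then d k else if i = t k then - d k else 0))"

definition total_flow :: "'k set \<Rightarrow> ('k, 'v) flow_family \<Rightarrow> 'v \<times> 'v \<Rightarrow> real" where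
  "total_flow K f e = (\<Sum>k\<in>K. f k e)"

definition penalty :: "('v \<times> 'v \<Rightarrow> real) \<Rightarrow> 'v \<times> 'v \<Rightarrow> real \<Rightarrow> real" where
  "penalty u e x = (if x \<le> u e then 0 else x - u e)"

definition total_penalty ::
  "'v pair_pre_digraph \<Rightarrow> ('v \<times> 'v \<Rightarrow> real) \<Rightarrow> 'k set \<Rightarrow> ('k, 'v) flow_family \<Rightarrow> real" where
  "total_penalty G u K f =
     (\<Sum>e\<in>parcs G. integral {0..total_flow K f e} (\<lambda>\<omega>. penalty u e \<omega>))"

definition optimal_pseudo_flow ::
  "'v pair_pre_digraph \<Rightarrow> ('v \<times> 'v \<Rightarrow> real) \<Rightarrow> 'k set \<Rightarrow> ('k \<Rightarrow> 'v) \<Rightarrow> ('k \<Rightarrow> 'v) \<Rightarrow> ('k \<Rightarrow> real)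
     \<Rightarrow> ('k, 'v) flow_family \<Rightarrow> bool" where
  "optimal_pseudo_flow G u K s t d f \<longleftrightarrow>
     is_arg_min (total_penalty G u K) (pseudo_flow G K s t d) f"

(* A path is given by its list of arcs; apath requires its vertices to be distinct. *)
definition paths :: "'v pair_pre_digraph \<Rightarrow> 'v \<Rightarrow> 'v \<Rightarrow> ('v \<times> 'v) list set" where
  "paths G a b = {p. pre_digraph.apath (with_proj G) a p b}"

definition path_length ::
  "('v \<times> 'v \<Rightarrow> real) \<Rightarrow> 'k set \<Rightarrow> ('k, 'v) flow_family \<Rightarrow> ('v \<times> 'v) list \<Rightarrow> real" where
  "path_length u K f p = (\<Sum>e\<leftarrow>p. penalty u e (total_flow K f e))"

definition used_paths ::
  "'v pair_pre_digraph \<Rightarrow> ('k \<Rightarrow> 'v) \<Rightarrow> ('k \<Rightarrow> 'v) \<Rightarrow> ('k, 'v) flow_family \<Rightarrow> 'k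
     \<Rightarrow> ('v \<times> 'v) list set" where
  "used_paths G s t f k = {p \<in> paths G (s k) (t k). \<forall>e\<in>set p. f k e > 0}"

definition unused_paths ::
  "'v pair_pre_digraph \<Rightarrow> ('k \<Rightarrow> 'v) \<Rightarrow> ('k \<Rightarrow> 'v) \<Rightarrow> ('k, 'v) flow_family \<Rightarrow> 'k
     \<Rightarrow> ('v \<times> 'v) list set" where
  "unused_paths G s t f k = paths G (s k) (t k) - used_paths G s t f k"

definition equilibrium_pseudo_flow ::
  "'v pair_pre_digraph \<Rightarrow> ('v \<times> 'v \<Rightarrow> real) \<Rightarrow> 'k set \<Rightarrow> ('k \<Rightarrow> 'v) \<Rightarrow> ('k \<Rightarrow> 'v) \<Rightarrow> ('k \<Rightarrow> real)
     \<Rightarrow> ('k, 'v) flow_family \<Rightarrow> bool" where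
  "equilibrium_pseudo_flow G u K s t d f \<longleftrightarrow>
     pseudo_flow G K s t d f \<and>
     (\<forall>k\<in>K.
        (\<forall>p\<in>used_paths G s t f k. \<forall>q\<in>used_paths G s t f k.
           path_length u K f p = path_length u K f q) \<and>
        (\<forall>p\<in>used_paths G s t f k.
           is_arg_min (path_length u K f) (\<lambda>q. q \<in> paths G (s k) (t k)) p) \<and>
        (\<forall>p\<in>used_paths G s t f k. \<forall>q\<in>unused_paths G s t f k.
           path_length u K f p \<le> path_length u K f q))"

end

(* Rerouting a small amount \<epsilon> of commodity k from a used path p to another path q keeps the pseudo-flow
   feasible and moves the flow on each arc by at most \<epsilon>. Since the penalties are 1-Lipschitz, the
   objective changes by at most \<epsilon> (length q - length p) plus a term of order \<epsilon>^2; if q were shorter than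
   p, this would be negative for small \<epsilon>, contradicting optimality. *)
theory Submission
  imports Defs
begin

text \<open>The function \<open>F\<close>, half the square of the positive part of y -
  \<open>u e\<close>, is an antiderivative of the penalty. It vanishes at 0 because the capacity is
  nonnegative, so the integral is just \<open>F x\<close>.\<close>

lemma integral_penalty:
  assumes "0 \<le> x" "0 \<le> u e"
  shows "integral {0..x} (penalty u e) = (penalty u e x)\<^sup>2 / 2"
proof -
  define F where "F y = (max 0 (y - u e))\<^sup>2 / 2" for y :: real
  have F: "F y = (penalty u e y)\<^sup>2 / 2" for y
    by (auto simp: F_def penalty_def max_def)
  have deriv: "(F has_vector_derivative penalty u e y) (at y)" if "y \<noteq> u e" for y
  proof (cases "y < u e")
    case True
    have "((\<lambda>_. 0) has_real_derivative penalty u e y) (at y)"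
      using True by (simp add: penalty_def)
    then have "(F has_real_derivative penalty u e y) (at y)"
      by (rule has_field_derivative_transform_within_open[where S = "{..<u e}"])
         (use True in \<open>auto simp: F_def\<close>)
    then show ?thesis
      by (simp add: has_real_derivative_iff_has_vector_derivative)
  next
    case False
    with that have "u e < y" by simp
    then have "((\<lambda>y. (y - u e)\<^sup>2 / 2) has_real_derivative penalty u e y) (at y)"
      by (auto intro!: derivative_eq_intros simp: penalty_def)
    then have "(F has_real_derivative penalty u e y) (at y)"
      by (rule has_field_derivative_transform_within_open[where S = "{u e<..}"])
         (use \<open>u e < y\<close> in \<open>auto simp: F_def\<close>)
    then show ?thesis
      by (simp add: has_real_derivative_iff_has_vector_derivative)
  qed
  \<comment> \<open>\<open>deriv\<close> covers only points off the kink at \<open>u e\<close>. This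
    form of the fundamental theorem tolerates a finite exceptional set as long as \<open>F\<close>
    is continuous.\<close>
  have "(penalty u e has_integral (F x - F 0)) {0..x}"
  proof (rule fundamental_theorem_of_calculus_interior_strong[where S = "{u e}"])
    show "continuous_on {0..x} F"
      unfolding F_def by (intro continuous_intros) simp
  qed (use assms deriv in auto)
  with assms show ?thesis
    by (auto simp: F penalty_def dest: integral_unique)
qed

text \<open>Where the penalty at x + \<delta> is positive it equals x + \<delta> -
  \<open>u e\<close>, and the penalty at x is at least x - \<open>u e\<close>. Comparing squares
  gives a first-order upper bound with remainder \<delta>^2 / 2, for \<delta> of either sign and
  across the kink.\<close>

lemma penalty_square_increment:
  "(penalty u e (x + \<delta>))\<^sup>2 / 2 - (penalty u e x)\<^sup>2 / 2 \<le> penalty u e x * \<delta> + \<delta>\<^sup>2 / 2"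
proof -
  have "(penalty u e (x + \<delta>))\<^sup>2 \<le> (penalty u e x + \<delta>)\<^sup>2"
    unfolding penalty_def abs_le_square_iff[symmetric] by auto
  then show ?thesis
    by (simp add: power2_sum)
qed

text \<open>Each arc contributes 1 at its tail and -1 at its head, so the contributions telescope
  along the walk. Counting arcs with multiplicity lets the induction run over arbitrary
  walks.\<close>

lemma awalk_count_balance:
  assumes "pair_fin_digraph G" "pre_digraph.awalk (with_proj G) a p b"
  shows "(\<Sum>j\<in>out_nbrs G i. real (count_list p (i, j)))
           - (\<Sum>j\<in>in_nbrs G i. real (count_list p (j, i)))
         = (if i = a then 1 else 0) - (if i = b then 1 else 0)"
  using assms(2)
proof (induction p arbitrary: a)
  case Nil
  then show ?case
    by (simp add: pre_digraph.awalk_def pre_digraph.cas.simps)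
next
  case (Cons e p)
  interpret pair_fin_digraph G by fact
  obtain x y where e: "e = (x, y)" by (cases e)
  from Cons.prems have walk: "awalk y p b" and arc: "(x, y) \<in> parcs G" and a: "a = x"
    by (auto simp: e awalk_Cons_iff)
  have "out_nbrs G i \<subseteq> snd ` parcs G" "in_nbrs G i \<subseteq> fst ` parcs G"
    by (force simp: out_nbrs_def in_nbrs_def)+
  then have fin: "finite (out_nbrs G i)" "finite (in_nbrs G i)"
    using pair_finite_arcs finite_subset by blast+
  have count: "real (count_list (e # p) z) = (if z = e then 1 else 0) + real (count_list p z)" for z
    by auto
  \<comment> \<open>Only j = y can contribute, and y is an out-neighbour of x because the first arc
    of the walk lies in the graph.\<close>
  have out: "(\<Sum>j\<in>out_nbrs G i. if (i, j) = e then 1 else 0) = (if i = x then 1 else 0::real)"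
  proof (cases "i = x")
    case True
    then show ?thesis
      using fin arc by (simp add: e out_nbrs_def)
  qed (simp add: e)
  have "in": "(\<Sum>j\<in>in_nbrs G i. if (j, i) = e then 1 else 0) = (if i = y then 1 else 0::real)"
  proof (cases "i = y")
    case True
    then show ?thesis
      using fin arc by (simp add: e in_nbrs_def)
  qed (simp add: e)
  show ?case
    using Cons.IH[OF walk] unfolding count sum.distrib out "in" a by simp
qed

text \<open>This turns path lengths into sums over all arcs, to be compared term by term with the
  objective.\<close>

lemma sum_list_map_eq_sum_count:
  fixes g :: "'a \<Rightarrow> real"
  assumes "finite A" "set p \<subseteq> A"
  shows "(\<Sum>e\<leftarrow>p. g e) = (\<Sum>e\<in>A. g e * real (count_list p e))"
  using assms(2)
proof (induction p)
  case (Cons a p)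
  have "(\<Sum>e\<in>A. g e * real (count_list (a # p) e))
      = (\<Sum>e\<in>A. (if e = a then g e else 0) + g e * real (count_list p e))"
    by (rule sum.cong) (auto simp: algebra_simps)
  with Cons assms(1) show ?case
    by (simp add: sum.distrib)
qed simp

text \<open>With counts, the change is linear in the two paths: shared arcs cancel, and flow
  conservation reduces to \<open>awalk_count_balance\<close>.\<close>

definition reroute ::
  "'k \<Rightarrow> real \<Rightarrow> ('v \<times> 'v) list \<Rightarrow> ('v \<times> 'v) list \<Rightarrow> ('k, 'v) flow_family \<Rightarrow> ('k, 'v) flow_family" where
  "reroute k \<epsilon> p q f =
     f(k := \<lambda>e. f k e + \<epsilon> * (real (count_list q e) - real (count_list p e)))"

lemma total_flow_reroute:
  assumes "finite K" "k \<in> K"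
  shows "total_flow K (reroute k \<epsilon> p q f) e =
           total_flow K f e + \<epsilon> * (real (count_list q e) - real (count_list p e))"
  using assms by (simp add: total_flow_def reroute_def sum.remove[of K k])

lemma paths_awalk: "p \<in> paths G a b \<Longrightarrow> pre_digraph.awalk (with_proj G) a p b"
  by (simp add: paths_def pre_digraph.apath_def)

lemma paths_subset_arcs: "p \<in> paths G a b \<Longrightarrow> set p \<subseteq> parcs G"
  by (drule paths_awalk) (simp add: pre_digraph.awalk_def)

text \<open>Distinct vertices force distinct arcs. Hence rerouting \<epsilon> changes the flow on an
  arc by at most \<epsilon>.\<close>

lemma count_list_path_le_1:
  assumes "pair_fin_digraph G" "p \<in> paths G a b"
  shows "count_list p e \<le> 1"
proof -
  interpret pair_fin_digraph G by fact
  have "distinct p"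
    using assms(2) distinct_verts_imp_distinct unfolding paths_def apath_def by auto
  then show ?thesis
    by (induction p) auto
qed

text \<open>An arc of \<open>p\<close> loses at most \<epsilon>, which it carries, and the other
  arcs lose nothing. Conservation survives because \<open>p\<close> and \<open>q\<close> have the
  same endpoints and so the same imbalance at every vertex.\<close>

lemma pseudo_flow_reroute:
  assumes G: "pair_fin_digraph G"
    and f: "pseudo_flow G K s t d f"
    and p: "p \<in> paths G (s k) (t k)" and q: "q \<in> paths G (s k) (t k)"
    and \<epsilon>: "0 \<le> \<epsilon>" "\<And>e. e \<in> set p \<Longrightarrow> \<epsilon> \<le> f k e"
  shows "pseudo_flow G K s t d (reroute k \<epsilon> p q f)"
  unfolding pseudo_flow_def
proof (intro conjI ballI)
  fix l e assume l: "l \<in> K" and e: "e \<in> parcs G"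
  with f have nonneg: "0 \<le> f l e"
    by (simp add: pseudo_flow_def)
  have "\<epsilon> * real (count_list p e) \<le> f k e" if "l = k"
  proof (cases "e \<in> set p")
    case True
    have "\<epsilon> * real (count_list p e) \<le> \<epsilon> * 1"
      using count_list_path_le_1[OF G p, of e] \<epsilon>(1) by (intro mult_left_mono) auto
    with \<epsilon>(2)[OF True] show ?thesis by simp
  qed (use nonneg that in simp)
  moreover have "0 \<le> \<epsilon> * real (count_list q e)"
    using \<epsilon>(1) by simp
  ultimately show "0 \<le> reroute k \<epsilon> p q f l e"
    using nonneg by (auto simp: reroute_def right_diff_distrib)
next
  fix l i assume "l \<in> K" "i \<in> pverts G"
  with f have cons: "(\<Sum>j\<in>out_nbrs G i. f l (i, j)) - (\<Sum>j\<in>in_nbrs G i. f l (j, i)) =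
      (if i = s l then d l else if i = t l then - d l else 0)"
    by (simp add: pseudo_flow_def)
  show "(\<Sum>j\<in>out_nbrs G i. reroute k \<epsilon> p q f l (i, j))
          - (\<Sum>j\<in>in_nbrs G i. reroute k \<epsilon> p q f l (j, i)) =
      (if i = s l then d l else if i = t l then - d l else 0)"
  proof (cases "l = k")
    case True
    have balance: "(\<Sum>j\<in>out_nbrs G i. real (count_list q (i, j)))
          - (\<Sum>j\<in>in_nbrs G i. real (count_list q (j, i)))
        = (\<Sum>j\<in>out_nbrs G i. real (count_list p (i, j)))
          - (\<Sum>j\<in>in_nbrs G i. real (count_list p (j, i)))"
      unfolding awalk_count_balance[OF G paths_awalk[OF p]]
        awalk_count_balance[OF G paths_awalk[OF q]] ..
    have "(\<Sum>j\<in>out_nbrs G i. reroute k \<epsilon> p q f l (i, j))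
          - (\<Sum>j\<in>in_nbrs G i. reroute k \<epsilon> p q f l (j, i))
        = (\<Sum>j\<in>out_nbrs G i. f l (i, j)) - (\<Sum>j\<in>in_nbrs G i. f l (j, i))
          + \<epsilon> * (((\<Sum>j\<in>out_nbrs G i. real (count_list q (i, j)))
                 - (\<Sum>j\<in>in_nbrs G i. real (count_list q (j, i))))
               - ((\<Sum>j\<in>out_nbrs G i. real (count_list p (i, j)))
                 - (\<Sum>j\<in>in_nbrs G i. real (count_list p (j, i)))))"
      using True
      by (simp add: reroute_def sum.distrib sum_subtractf sum_distrib_left[symmetric] algebra_simps)
    with cons balance show ?thesis
      by simp
  qed (use cons in \<open>simp add: reroute_def\<close>)
qed

text \<open>Total flows are nonnegative, so \<open>integral_penalty\<close> applies on every arc and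
  removes the integrals from the rest of the argument.\<close>

lemma total_penalty_eq_sum_squares:
  assumes "\<And>e. e \<in> parcs G \<Longrightarrow> 0 < u e" "pseudo_flow G K s t d f"
  shows "total_penalty G u K f = (\<Sum>e\<in>parcs G. (penalty u e (total_flow K f e))\<^sup>2 / 2)"
  unfolding total_penalty_def
proof (rule sum.cong)
  fix e assume "e \<in> parcs G"
  moreover from this assms(2) have "0 \<le> total_flow K f e"
    unfolding total_flow_def pseudo_flow_def by (intro sum_nonneg) auto
  ultimately show "integral {0..total_flow K f e} (penalty u e)
      = (penalty u e (total_flow K f e))\<^sup>2 / 2"
    using assms(1)[of e] by (intro integral_penalty) simp_all
qed simp

text \<open>Apply \<open>penalty_square_increment\<close> on each arc with \<delta> =
  \<open>\<epsilon> * ?\<Delta> e\<close>. The linear terms add up to \<epsilon> times the length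
  difference, and each remainder is at most \<epsilon>^2 / 2 because \<open>?\<Delta> e\<close> is
  -1, 0 or 1.\<close>

lemma total_penalty_reroute_le:
  assumes G: "pair_fin_digraph G"
    and u: "\<And>e. e \<in> parcs G \<Longrightarrow> 0 < u e"
    and K: "finite K" "k \<in> K"
    and f: "pseudo_flow G K s t d f"
    and p: "p \<in> paths G (s k) (t k)" and q: "q \<in> paths G (s k) (t k)"
    and \<epsilon>: "0 \<le> \<epsilon>" "\<And>e. e \<in> set p \<Longrightarrow> \<epsilon> \<le> f k e"
  shows "total_penalty G u K (reroute k \<epsilon> p q f) - total_penalty G u K f
           \<le> \<epsilon> * (path_length u K f q - path_length u K f p) + real (card (parcs G)) * \<epsilon>\<^sup>2 / 2"
proof -
  interpret pair_fin_digraph G by fact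
  let ?h = "\<lambda>e. penalty u e (total_flow K f e)"
  let ?\<Delta> = "\<lambda>e. real (count_list q e) - real (count_list p e)"
  have length: "path_length u K f r = (\<Sum>e\<in>parcs G. ?h e * real (count_list r e))"
    if "r \<in> paths G (s k) (t k)" for r
    unfolding path_length_def
    by (rule sum_list_map_eq_sum_count[OF pair_finite_arcs paths_subset_arcs[OF that]])
  have square: "(?\<Delta> e)\<^sup>2 \<le> 1" for e
    using count_list_path_le_1[OF G p, of e] count_list_path_le_1[OF G q, of e]
    by (simp add: abs_square_le_1)
  have "total_penalty G u K (reroute k \<epsilon> p q f) - total_penalty G u K f
      = (\<Sum>e\<in>parcs G. (penalty u e (total_flow K f e + \<epsilon> * ?\<Delta> e))\<^sup>2 / 2 - (?h e)\<^sup>2 / 2)"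
    using total_penalty_eq_sum_squares[OF u f]
      total_penalty_eq_sum_squares[OF u pseudo_flow_reroute[OF G f p q \<epsilon>]]
    by (simp add: total_flow_reroute[OF K] sum_subtractf)
  also have "\<dots> \<le> (\<Sum>e\<in>parcs G. \<epsilon> * (?h e * ?\<Delta> e) + \<epsilon>\<^sup>2 / 2)"
  proof (rule sum_mono)
    fix e
    have "(\<epsilon> * ?\<Delta> e)\<^sup>2 \<le> \<epsilon>\<^sup>2"
      unfolding power_mult_distrib using mult_left_mono[OF square, of "\<epsilon>\<^sup>2"] by simp
    with penalty_square_increment[of u e "total_flow K f e" "\<epsilon> * ?\<Delta> e"]
    show "(penalty u e (total_flow K f e + \<epsilon> * ?\<Delta> e))\<^sup>2 / 2 - (?h e)\<^sup>2 / 2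
        \<le> \<epsilon> * (?h e * ?\<Delta> e) + \<epsilon>\<^sup>2 / 2"
      by (simp add: mult.left_commute)
  qed
  also have "\<dots> = \<epsilon> * (path_length u K f q - path_length u K f p)
      + real (card (parcs G)) * \<epsilon>\<^sup>2 / 2"
    by (simp add: length[OF p] length[OF q] sum.distrib sum_distrib_left[symmetric]
        sum_subtractf right_diff_distrib)
  finally show ?thesis .
qed

lemma optimal_used_path_shortest:
  assumes G: "pair_fin_digraph G"
    and u: "\<And>e. e \<in> parcs G \<Longrightarrow> 0 < u e"
    and K: "finite K" "k \<in> K"
    and opt: "optimal_pseudo_flow G u K s t d f"
    and p: "p \<in> used_paths G s t f k" and q: "q \<in> paths G (s k) (t k)"
  shows "path_length u K f p \<le> path_length u K f q"
proof (rule ccontr)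
  assume "\<not> ?thesis"
  then have gap: "0 < path_length u K f p - path_length u K f q" (is "0 < ?g")
    by simp
  have f: "pseudo_flow G K s t d f"
    and min: "\<And>g. pseudo_flow G K s t d g \<Longrightarrow> total_penalty G u K f \<le> total_penalty G u K g"
    using opt by (auto simp: optimal_pseudo_flow_def is_arg_min_linorder)
  have p': "p \<in> paths G (s k) (t k)" and pos: "\<And>e. e \<in> set p \<Longrightarrow> 0 < f k e"
    using p by (auto simp: used_paths_def)
  let ?n = "real (card (parcs G))"
  \<comment> \<open>The flows along \<open>p\<close> keep the rerouting feasible, and
    \<open>?g / (?n + 1)\<close> keeps the quadratic term below the linear gain. The added 1 makes
    the denominator positive.\<close>
  define \<epsilon> where "\<epsilon> = Min (insert (?g / (?n + 1)) (f k ` set p))"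
  have \<epsilon>: "0 < \<epsilon>" "\<epsilon> \<le> ?g / (?n + 1)" "\<And>e. e \<in> set p \<Longrightarrow> \<epsilon> \<le> f k e"
    using gap pos by (auto simp: \<epsilon>_def)
  have "0 \<le> total_penalty G u K (reroute k \<epsilon> p q f) - total_penalty G u K f"
    using min[OF pseudo_flow_reroute[OF G f p' q]] \<epsilon> by simp
  also have "\<dots> \<le> \<epsilon> * (- ?g) + ?n * \<epsilon>\<^sup>2 / 2"
    using total_penalty_reroute_le[OF G u K f p' q] \<epsilon> by simp
  also have "\<dots> = \<epsilon> * (?n * \<epsilon> / 2 - ?g)"
    by (simp add: power2_eq_square algebra_simps)
  \<comment> \<open>Cancelling \<epsilon> > 0 leaves this bound. The choice of \<epsilon> gives
    \<open>?n * \<epsilon> + \<epsilon> \<le> ?g\<close>, and together they would force \<epsilon>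
    \<le> 0.\<close>
  finally have "?g \<le> ?n * \<epsilon> / 2"
    using \<epsilon>(1) by (simp add: zero_le_mult_iff)
  moreover have "(?n + 1) * \<epsilon> \<le> ?g"
    using \<epsilon>(2) by (simp add: pos_le_divide_eq mult.commute)
  moreover have "0 \<le> ?n * \<epsilon>"
    using \<epsilon>(1) by simp
  ultimately show False
    using \<epsilon>(1) by (simp add: distrib_right)
qed

theorem mainTheorem3:
  fixes G :: "'v pair_pre_digraph"
    and u :: "'v \<times> 'v \<Rightarrow> real"
    and K :: "'k set"
    and s t :: "'k \<Rightarrow> 'v"
    and d :: "'k \<Rightarrow> real"
    and f :: "('k, 'v) flow_family"
  assumes "pair_fin_digraph G"
    and "\<And>e. e \<in> parcs G \<Longrightarrow> u e \<in> \<rat> \<and> 0 < u e"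
    and "finite K"
    and "\<And>k. k \<in> K \<Longrightarrow> s k \<in> pverts G \<and> t k \<in> pverts G \<and> s k \<noteq> t k \<and> 0 \<le> d k"
    and "optimal_pseudo_flow G u K s t d f"
  shows "equilibrium_pseudo_flow G u K s t d f"
proof -
  have shortest: "path_length u K f p \<le> path_length u K f q"
    if "k \<in> K" "p \<in> used_paths G s t f k" "q \<in> paths G (s k) (t k)" for k p q
    using optimal_used_path_shortest[OF assms(1) _ assms(3) that(1) assms(5) that(2,3)] assms(2)
    by blast
  have sub: "used_paths G s t f k \<subseteq> paths G (s k) (t k)"
    "unused_paths G s t f k \<subseteq> paths G (s k) (t k)" for k
    by (auto simp: used_paths_def unused_paths_def)
  have "pseudo_flow G K s t d f"
    using assms(5) by (simp add: optimal_pseudo_flow_def is_arg_min_def)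
  \<comment> \<open>All the path conditions are instances of \<open>shortest\<close>; two used paths
    have equal length because each is at most as long as the other.\<close>
  with shortest sub show ?thesis
    unfolding equilibrium_pseudo_flow_def is_arg_min_linorder
    by (intro conjI ballI antisym) blast+
qed

end
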